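(* Let $\eta\in(0,1)$ and let $\kappa:\mathbb{Z}_{>0}\to(0,\infty)$ satisfy $\kappa(m)=o(m)$ as $m\to\infty$. Then there exists an integer $m_0\ge 1$ such that for every integer $m\ge m_0$ there exist integers $n,d\ge 1$ with $n+d=m$ and a convex body $C\subset\mathbb{R}^{n+d}$ such that, writing $S:=C\cap(\mathbb{Z}^n\times\mathbb{R}^d)$, the projection $\operatorname{proj}_{\mathbb{R}^n}(C)$ contains a translate of $\kappa(m)\,\mathbb{B}_\infty^n$ but $$\sup_{y\in S}h_S(y)\ \le\ \eta\,\mathcal{H}_d(S).$$ Equivalently, no function $\kappa:\mathbb{Z}_{>0}\to(0,\infty)$ with $\kappa(m)=o(m)$ can serve as a threshold, based only on the dimension, that guarantees a dimension-free constant fraction lower bound for mixed-integer halfspace depth; that is, for no such $\kappa$ does there exist a constant $c>0$ such that for all integers $n,d\ge1$ and every convex body $C\subset\mathbb{R}^{n+d}$ whose projection $\operatorname{proj}_{\mathbb{R}^n}(C)$ contains a translate of $\kappa(n+d)\,\mathbb{B}_\infty^n$, the set $S=C\cap(\mathbb{Z}^n\times\mathbb{R}^d)$ contains a point $y$ with $h_S(y)\ge c\,\mathcal{H}_d(S)$.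
   Context: A convex body is a compact convex set with nonempty interior. Points of $\mathbb{R}^{n+d}=\mathbb{R}^n\times\mathbb{R}^d$ are written $(z,x)$, and $\operatorname{proj}_{\mathbb{R}^n}(z,x)=z$; the projection of a set is its image. $\mathbb{B}_\infty^n=\{u\in\mathbb{R}^n:\|u\|_\infty\le 1\}$. For a measurable set $A\subseteq\mathbb{Z}^n\times\mathbb{R}^d$, the mixed-integer volume is $\mathcal{H}_d(A)=\sum_{z\in\mathbb{Z}^n}\operatorname{vol}_d(A_z)$, where $A_z=\{x\in\mathbb{R}^d:(z,x)\in A\}$ and $\operatorname{vol}_d$ is $d$-dimensional Lebesgue measure. A closed halfspace in $\mathbb{R}^{n+d}$ is a set $\{y: a^{\mathsf T}y\ge c\}$ with $a\ne 0$, $c\in\mathbb{R}$. For $y\in S$ the halfspace depth is $h_S(y)=\inf\{\mathcal{H}_d(S\cap H): H\subset\mathbb{R}^{n+d}\text{ a closed halfspace with }y\in H\}$. *)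

theory Defs
  imports "HOL-Analysis.Analysis" "HOL-Library.Landau_Symbols"
begin

text \<open>
  Dimensions are quantified inside the statement, so \<open>\<real>\<^sup>m\<close> is the carrier \<open>{..<m} \<rightarrow>\<^sub>E UNIV\<close> of
  extensional functions, which is both the space of \<open>Pi\<^sub>M {..<m} (\<lambda>_. lborel)\<close> and the topspace
  of the product topology. In \<open>\<real>\<^sup>n\<^sup>+\<^sup>d = \<real>\<^sup>n \<times> \<real>\<^sup>d\<close> the factor \<open>\<real>\<^sup>n\<close> has the coordinates \<open>{..<n}\<close> and the
  factor \<open>\<real>\<^sup>d\<close> the coordinates \<open>{n..<n+d}\<close>; the point \<open>(z, x)\<close> is
  \<open>merge {..<n} {n..<n+d} (z, x)\<close>.
\<close>

abbreviation coord_space :: "nat set \<Rightarrow> (nat \<Rightarrow> real) set" where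
  "coord_space I \<equiv> I \<rightarrow>\<^sub>E UNIV"

abbreviation coord_topology :: "nat set \<Rightarrow> (nat \<Rightarrow> real) topology" where
  "coord_topology I \<equiv> product_topology (\<lambda>_. euclideanreal) I"

abbreviation coord_lebesgue :: "nat set \<Rightarrow> (nat \<Rightarrow> real) measure" where
  "coord_lebesgue I \<equiv> completion (Pi\<^sub>M I (\<lambda>_. lborel))"

definition coord_convex :: "nat set \<Rightarrow> (nat \<Rightarrow> real) set \<Rightarrow> bool" where
  "coord_convex I C \<longleftrightarrow>
    (\<forall>x\<in>C. \<forall>y\<in>C. \<forall>u\<ge>0. \<forall>v\<ge>0. u + v = 1 \<longrightarrow> (\<lambda>i\<in>I. u * x i + v * y i) \<in> C)"

definition convex_body :: "nat set \<Rightarrow> (nat \<Rightarrow> real) set \<Rightarrow> bool" where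
  "convex_body I C \<longleftrightarrow>
    compactin (coord_topology I) C \<and> coord_convex I C \<and> (coord_topology I) interior_of C \<noteq> {}"

definition closed_halfspace :: "nat \<Rightarrow> (nat \<Rightarrow> real) set \<Rightarrow> bool" where
  "closed_halfspace m H \<longleftrightarrow>
    (\<exists>a c. (\<exists>i<m. a i \<noteq> 0) \<and> H = {y \<in> coord_space {..<m}. (\<Sum>i<m. a i * y i) \<ge> c})"

text \<open>Only meaningful for \<open>n \<ge> 1\<close>.\<close>

definition linf_norm :: "nat \<Rightarrow> (nat \<Rightarrow> real) \<Rightarrow> real" where
  "linf_norm n u = Max ((\<lambda>i. \<bar>u i\<bar>) ` {..<n})"

definition linf_ball :: "nat \<Rightarrow> (nat \<Rightarrow> real) set" where
  "linf_ball n = {u \<in> coord_space {..<n}. linf_norm n u \<le> 1}"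

definition contains_translate :: "nat \<Rightarrow> (nat \<Rightarrow> real) set \<Rightarrow> real \<Rightarrow> (nat \<Rightarrow> real) set \<Rightarrow> bool" where
  "contains_translate n P r B \<longleftrightarrow>
    (\<exists>t \<in> coord_space {..<n}. (\<lambda>u. \<lambda>i\<in>{..<n}. t i + r * u i) ` B \<subseteq> P)"

definition proj :: "nat \<Rightarrow> (nat \<Rightarrow> real) set \<Rightarrow> (nat \<Rightarrow> real) set" where
  "proj n C = (\<lambda>y. restrict y {..<n}) ` C"

definition int_points :: "nat \<Rightarrow> (nat \<Rightarrow> real) set" where
  "int_points n = {..<n} \<rightarrow>\<^sub>E \<int>"

definition mixed_integer_points :: "nat \<Rightarrow> nat \<Rightarrow> (nat \<Rightarrow> real) set" where
  "mixed_integer_points n d =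
    merge {..<n} {n..<n+d} ` (int_points n \<times> coord_space {n..<n+d})"

definition fibre :: "nat \<Rightarrow> nat \<Rightarrow> (nat \<Rightarrow> real) set \<Rightarrow> (nat \<Rightarrow> real) \<Rightarrow> (nat \<Rightarrow> real) set" where
  "fibre n d A z = {x \<in> coord_space {n..<n+d}. merge {..<n} {n..<n+d} (z, x) \<in> A}"

definition mixed_integer_volume :: "nat \<Rightarrow> nat \<Rightarrow> (nat \<Rightarrow> real) set \<Rightarrow> ennreal" where
  "mixed_integer_volume n d A =
    (\<Sum>\<^sub>\<infinity>z\<in>int_points n. emeasure (coord_lebesgue {n..<n+d}) (fibre n d A z))"

definition halfspace_depth :: "nat \<Rightarrow> nat \<Rightarrow> (nat \<Rightarrow> real) set \<Rightarrow> (nat \<Rightarrow> real) \<Rightarrow> ennreal" where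
  "halfspace_depth n d S y =
    (INF H\<in>{H. closed_halfspace (n + d) H \<and> y \<in> H}. mixed_integer_volume n d (S \<inter> H))"

end

theory Submission
  imports Defs
begin

text \<open>
  Fix \<open>n\<close> with \<open>2\<^sup>-\<^sup>n \<le> \<eta>/2\<close>, put \<open>d = m - n\<close>, \<open>R = n \<kappa>(m)\<close> and \<open>e(a) = \<bar>a - 1/2\<bar> - 1/2\<close>, which vanishes at
  \<open>0\<close> and \<open>1\<close> and is a positive integer at every other integer. Over \<open>z\<close> the convex body
  \<open>\<bar>x\<^sub>j\<bar> + \<Sum>\<^sub>i e(z\<^sub>i) \<le> R\<close> has a cube of half-side \<open>R - \<Sum>\<^sub>i e(z\<^sub>i)\<close> as its fibre, of volume at most
  \<open>(2R)\<^sup>d q\<^bsup>\<Sum>e(z\<^sub>i)\<^esup>\<close> with \<open>q = exp (- d/R)\<close>. As \<open>\<kappa>(m) = o(m)\<close>, \<open>q\<close> tends to \<open>0\<close>, so nearly all of the mass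
  \<open>\<le> (2R)\<^sup>d (2/(1-q))\<^sup>n\<close> is spread evenly over the \<open>2\<^sup>n\<close> vertices of \<open>{0,1}\<^sup>n\<close>. A point with integer
  part \<open>z\<close> lies in the halfspace \<open>\<Sum>\<^sub>i a\<^sub>i (w\<^sub>i - z\<^sub>i) \<ge> 0\<close>, \<open>a\<^sub>i = 1\<close> if \<open>z\<^sub>i \<ge> 1\<close> and \<open>a\<^sub>i = -1\<close> otherwise, which
  contains no vertex other than possibly \<open>z\<close> itself.
\<close>

section \<open>The convex body and its projection\<close>

definition excess :: "real \<Rightarrow> real" where
  "excess a = \<bar>a - 1/2\<bar> - 1/2"

text \<open>A sublevel set of the sup norm of \<open>x\<close> plus the total excess of
  \<open>z\<close>, with the maximum spelled out as one constraint per continuous coordinate. For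
  \<open>d = 0\<close> there would be no constraint at all.\<close>

definition excess_body :: "nat \<Rightarrow> nat \<Rightarrow> real \<Rightarrow> (nat \<Rightarrow> real) set" where
  "excess_body n d R =
    {y \<in> coord_space {..<n+d}. \<forall>j\<in>{n..<n+d}. \<bar>y j\<bar> + (\<Sum>i<n. excess (y i)) \<le> R}"

lemma excess_01 [simp]: "excess 0 = 0" "excess 1 = 0"
  by (auto simp: excess_def)

lemma excess_ge: "excess a \<ge> - (1/2)"
  by (simp add: excess_def)

lemma excess_nonneg_Ints:
  assumes "a \<in> \<int>"
  shows "excess a \<ge> 0"
proof -
  obtain k :: int where "a = of_int k" using assms by (auto elim: Ints_cases)
  moreover have "k \<ge> 1 \<or> k \<le> 0" by linarith
  ultimately show ?thesis unfolding excess_def by (auto simp: abs_if)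
qed

lemma excess_convex:
  assumes "u \<ge> 0" "v \<ge> 0" "u + v = 1"
  shows "excess (u * a + v * b) \<le> u * excess a + v * excess b"
proof -
  have "u * a + v * b - (u + v) / 2 = u * (a - 1/2) + v * (b - 1/2)"
    by (simp add: right_diff_distrib add_divide_distrib)
  then have "\<bar>u * a + v * b - 1/2\<bar> \<le> u * \<bar>a - 1/2\<bar> + v * \<bar>b - 1/2\<bar>"
    using abs_triangle_ineq[of "u * (a - 1/2)" "v * (b - 1/2)"] assms
    by (simp add: abs_mult)
  moreover have "u * excess a + v * excess b
      = u * \<bar>a - 1/2\<bar> + v * \<bar>b - 1/2\<bar> - (u + v) / 2"
    by (simp add: excess_def right_diff_distrib add_divide_distrib)
  ultimately show ?thesis
    using assms by (simp add: excess_def)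
qed

lemma coord_convex_excess_body: "coord_convex {..<n+d} (excess_body n d R)"
  unfolding coord_convex_def
proof (intro ballI allI impI)
  fix x y and u v :: real
  assume x: "x \<in> excess_body n d R" and y: "y \<in> excess_body n d R"
    and u: "u \<ge> 0" and v: "v \<ge> 0" and uv: "u + v = 1"
  let ?w = "\<lambda>i\<in>{..<n+d}. u * x i + v * y i"
  have "\<bar>?w j\<bar> + (\<Sum>i<n. excess (?w i)) \<le> R" if j: "j \<in> {n..<n+d}" for j
  proof -
    have "(\<Sum>i<n. excess (?w i)) \<le> (\<Sum>i<n. u * excess (x i) + v * excess (y i))"
      using excess_convex[OF u v uv] by (intro sum_mono) auto
    also have "\<dots> = u * (\<Sum>i<n. excess (x i)) + v * (\<Sum>i<n. excess (y i))"
      by (simp add: sum.distrib sum_distrib_left)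
    finally have 1: "(\<Sum>i<n. excess (?w i)) \<le> \<dots>" .
    have 2: "\<bar>?w j\<bar> \<le> u * \<bar>x j\<bar> + v * \<bar>y j\<bar>"
      using abs_triangle_ineq[of "u * x j" "v * y j"] u v j by (simp add: abs_mult)
    have 3: "u * (\<bar>x j\<bar> + (\<Sum>i<n. excess (x i))) \<le> u * R"
      "v * (\<bar>y j\<bar> + (\<Sum>i<n. excess (y i))) \<le> v * R"
      using x y j u v by (auto simp: excess_body_def intro!: mult_left_mono)
    have "u * R + v * R = R" using uv by (metis distrib_right mult_1)
    then show ?thesis using 1 2 3 by (simp add: distrib_left)
  qed
  then show "?w \<in> excess_body n d R"
    by (auto simp: excess_body_def)
qed

lemma compactin_excess_body:
  assumes "d \<ge> 1"
  shows "compactin (coord_topology {..<n+d}) (excess_body n d R)"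
proof (rule closed_compactin)
  \<comment> \<open>A generous bound: every excess is at least -1/2, so the continuous coordinates
    are at most R + n/2 in absolute value and the first \<open>n\<close> coordinates at most R + n/2
    + 1/2.\<close>
  define B where "B = \<bar>R\<bar> + real n + 1"
  show "compactin (coord_topology {..<n+d}) (PiE {..<n+d} (\<lambda>_. {-B..B}))"
    by (simp add: compactin_PiE)
  show "excess_body n d R \<subseteq> PiE {..<n+d} (\<lambda>_. {-B..B})"
  proof
    fix y assume y: "y \<in> excess_body n d R"
    have 0: "\<bar>y j\<bar> + (\<Sum>i<n. excess (y i)) \<le> R" if "j \<in> {n..<n+d}" for j
      using y that by (auto simp: excess_body_def)
    have "(\<Sum>i<n. -(1/2)) \<le> (\<Sum>i<n. excess (y i))"
      by (intro sum_mono excess_ge)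
    then have sum_ge: "(\<Sum>i<n. excess (y i)) \<ge> - (real n / 2)" by simp
    have "y i \<in> {-B..B}" if i: "i < n + d" for i
    proof (cases "i < n")
      case True
      have "(\<Sum>k\<in>{..<n}-{i}. -(1/2)) \<le> (\<Sum>k\<in>{..<n}-{i}. excess (y k))"
        by (intro sum_mono excess_ge)
      then have "- (real n / 2) + 1/2 \<le> (\<Sum>k\<in>{..<n}-{i}. excess (y k))"
        using True by (simp add: of_nat_diff field_simps)
      moreover have "(\<Sum>k<n. excess (y k)) = excess (y i) + (\<Sum>k\<in>{..<n}-{i}. excess (y k))"
        using True by (simp add: sum.remove)
      \<comment> \<open>Index \<open>n\<close> is the first continuous coordinate, available because
        \<open>d \<ge> 1\<close>; dropping its absolute value bounds the total excess.\<close>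
      moreover have "(\<Sum>k<n. excess (y k)) \<le> R"
        using 0[of n] assms by simp
      ultimately show ?thesis unfolding B_def excess_def using True by (simp add: abs_if split: if_splits)
    next
      case False
      then show ?thesis using 0[of i] sum_ge i unfolding B_def by (simp add: abs_if split: if_splits)
    qed
    then show "y \<in> PiE {..<n+d} (\<lambda>_. {-B..B})"
      using y by (auto simp: excess_body_def PiE_iff)
  qed
  have *: "closedin (coord_topology {..<n+d})
     {y \<in> topspace (coord_topology {..<n+d}). \<bar>y j\<bar> + (\<Sum>i<n. excess (y i)) \<in> {..R}}"
    if "j \<in> {n..<n+d}" for j
    unfolding excess_def using that
    by (intro closedin_continuous_map_preimage[where Y = euclideanreal] continuous_intros
        continuous_map_real_abs continuous_map_product_projection) auto
  have "excess_body n d R = (\<Inter>j\<in>{n..<n+d}.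
     {y \<in> topspace (coord_topology {..<n+d}). \<bar>y j\<bar> + (\<Sum>i<n. excess (y i)) \<in> {..R}})"
  proof
    show "(\<Inter>j\<in>{n..<n+d}. {y \<in> topspace (coord_topology {..<n+d}).
        \<bar>y j\<bar> + (\<Sum>i<n. excess (y i)) \<in> {..R}}) \<subseteq> excess_body n d R"
    proof
      fix y assume *: "y \<in> (\<Inter>j\<in>{n..<n+d}. {y \<in> topspace (coord_topology {..<n+d}).
        \<bar>y j\<bar> + (\<Sum>i<n. excess (y i)) \<in> {..R}})"
      have "n \<in> {n..<n+d}" using assms by simp
      with * have "y \<in> topspace (coord_topology {..<n+d})" by blast
      with * show "y \<in> excess_body n d R" by (simp add: excess_body_def)
    qed
  qed (auto simp: excess_body_def)
  also have "closedin (coord_topology {..<n+d}) \<dots>"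
    using * assms by (intro closedin_INT) auto
  finally show "closedin (coord_topology {..<n+d}) (excess_body n d R)" .
qed

lemma interior_excess_body:
  assumes "R > 0"
  shows "(coord_topology {..<n+d}) interior_of (excess_body n d R) \<noteq> {}"
proof -
  \<comment> \<open>Over the open unit cube every excess is negative, so the full range of
    \<open>x\<close> between \<open>-R\<close> and \<open>R\<close> is available.\<close>
  let ?U = "PiE {..<n+d} (\<lambda>i. if i < n then {0<..<1} else {-R<..<R})"
  have "(\<lambda>i\<in>{..<n+d}. if i < n then 1/2 else 0) \<in> ?U"
    using assms by auto
  moreover have "openin (coord_topology {..<n+d}) ?U"
    by (subst openin_PiE) auto
  moreover have "?U \<subseteq> excess_body n d R"
  proof
    fix y assume y: "y \<in> ?U"
    have "(\<Sum>i<n. excess (y i)) \<le> (\<Sum>i<n. 0)"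
    proof (intro sum_mono)
      fix i assume "i \<in> {..<n}"
      then have "y i \<in> {0<..<1}" using y by (auto simp: PiE_iff dest!: bspec[where x = i])
      then show "excess (y i) \<le> 0" by (auto simp: excess_def abs_if)
    qed
    moreover have "\<bar>y j\<bar> < R" if "j \<in> {n..<n+d}" for j
    proof -
      have "y j \<in> {-R<..<R}" using y that by (auto simp: PiE_iff dest!: bspec[where x = j])
      then show ?thesis by auto
    qed
    ultimately show "y \<in> excess_body n d R"
      using y by (fastforce simp: excess_body_def PiE_iff)
  qed
  ultimately show ?thesis
    using interior_of_maximal by blast
qed

lemma convex_body_excess_body:
  assumes "d \<ge> 1" "R > 0"
  shows "convex_body {..<n+d} (excess_body n d R)"
  using assms compactin_excess_body coord_convex_excess_body interior_excess_body
  by (simp add: convex_body_def)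

text \<open>Around the centre 1/2 a shift by r u has excess r |u| - 1/2, hence at most
  \<open>r\<close>. Adding this over the \<open>n\<close> coordinates explains the size
  \<open>real n * r\<close> of the body.\<close>

lemma contains_translate_excess_body:
  assumes n: "n \<ge> 1" and r: "r \<ge> 0"
  shows "contains_translate n (proj n (excess_body n d (real n * r))) r (linf_ball n)"
proof -
  let ?t = "\<lambda>i\<in>{..<n}. 1/2 :: real"
  have "(\<lambda>i\<in>{..<n}. ?t i + r * u i) \<in> proj n (excess_body n d (real n * r))"
    if u: "u \<in> linf_ball n" for u
  proof -
    let ?y = "\<lambda>i\<in>{..<n+d}. if i < n then 1/2 + r * u i else 0"
    have le1: "\<bar>u i\<bar> \<le> 1" if "i < n" for i
    proof -
      have "\<bar>u i\<bar> \<le> linf_norm n u"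
        unfolding linf_norm_def using that by (intro Max_ge) auto
      then show ?thesis using u by (simp add: linf_ball_def)
    qed
    have "(\<Sum>i<n. excess (?y i)) \<le> (\<Sum>i<n. r)"
    proof (intro sum_mono)
      fix i assume i: "i \<in> {..<n}"
      have "\<bar>r * u i\<bar> \<le> r" using le1[of i] i r by (simp add: abs_mult mult_left_le)
      then show "excess (?y i) \<le> r" using i by (simp add: excess_def)
    qed
    then have "?y \<in> excess_body n d (real n * r)"
      by (auto simp: excess_body_def)
    moreover have "(\<lambda>i\<in>{..<n}. ?t i + r * u i) = restrict ?y {..<n}"
      by auto
    ultimately show ?thesis unfolding proj_def by blast
  qed
  then show ?thesis
    unfolding contains_translate_def by (intro bexI[of _ ?t]) auto
qed

section \<open>Fibres and mixed-integer volume\<close>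

text \<open>For negative \<open>r\<close> the interval is empty, and \<open>max 0 r\<close> yields
  volume 0 because \<open>d \<ge> 1\<close> excludes \<open>0 ^ 0\<close>.\<close>

lemma emeasure_coord_cube:
  assumes "d \<ge> 1"
  shows "emeasure (coord_lebesgue {n..<n+d}) (PiE {n..<n+d} (\<lambda>_. {-r..r}))
    = ennreal ((2 * max 0 r) ^ d)"
proof -
  interpret product_sigma_finite "\<lambda>_::nat. lborel :: real measure" ..
  have "PiE {n..<n+d} (\<lambda>_. {-r..r}) \<in> sets (Pi\<^sub>M {n..<n+d} (\<lambda>_. lborel))"
    by (intro sets_PiM_I_finite) auto
  then have "emeasure (coord_lebesgue {n..<n+d}) (PiE {n..<n+d} (\<lambda>_. {-r..r}))
    = (\<Prod>i\<in>{n..<n+d}. emeasure lborel {-r..r})"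
    by (simp add: emeasure_PiM)
  also have "\<dots> = ennreal (2 * max 0 r) ^ d"
    by (auto simp: emeasure_lborel_Icc_eq max_def)
  finally show ?thesis by (simp add: ennreal_power)
qed

lemma fibre_excess_body:
  assumes z: "z \<in> int_points n"
  shows "fibre n d (excess_body n d R \<inter> mixed_integer_points n d) z
    = PiE {n..<n+d} (\<lambda>_. {-(R - (\<Sum>i<n. excess (z i)))..R - (\<Sum>i<n. excess (z i))})"
proof -
  have *: "{..<n+d} = {..<n} \<union> {n..<n+d}" by auto
  have e: "(\<Sum>i<n. excess (merge {..<n} {n..<n+d} (z, x) i)) = (\<Sum>i<n. excess (z i))" for x
    by (intro sum.cong) (auto simp: merge_def)
  have m: "merge {..<n} {n..<n+d} (z, x) j = x j" if "j \<in> {n..<n+d}" for x j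
    using that by (auto simp: merge_def)
  have ext: "merge {..<n} {n..<n+d} (z, x) \<in> coord_space {..<n+d}" for x
    unfolding * by (auto simp: PiE_def)
  have mem: "merge {..<n} {n..<n+d} (z, x) \<in> mixed_integer_points n d"
    if "x \<in> coord_space {n..<n+d}" for x
    unfolding mixed_integer_points_def using z that by blast
  have iff: "merge {..<n} {n..<n+d} (z, x) \<in> excess_body n d R \<longleftrightarrow>
      (\<forall>j\<in>{n..<n+d}. \<bar>x j\<bar> + (\<Sum>i<n. excess (z i)) \<le> R)" for x
    unfolding excess_body_def using ext[of x] by (simp add: e m cong: ball_cong_simp)
  have "x \<in> fibre n d (excess_body n d R \<inter> mixed_integer_points n d) z \<longleftrightarrow>
      x \<in> coord_space {n..<n+d} \<and> (\<forall>j\<in>{n..<n+d}. \<bar>x j\<bar> + (\<Sum>i<n. excess (z i)) \<le> R)" for x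
    unfolding fibre_def using mem iff by blast
  moreover have "\<bar>a\<bar> + s \<le> R \<longleftrightarrow> a \<in> {-(R - s)..R - s}" for a s :: real
    by auto
  ultimately show ?thesis by (auto simp: PiE_iff extensional_def)
qed

lemma mixed_integer_volume_eq_sum:
  assumes "finite F" "F \<subseteq> int_points n"
    and "\<And>z. z \<in> int_points n - F \<Longrightarrow> emeasure (coord_lebesgue {n..<n+d}) (fibre n d A z) = 0"
  shows "mixed_integer_volume n d A
    = (\<Sum>z\<in>F. emeasure (coord_lebesgue {n..<n+d}) (fibre n d A z))"
proof -
  have "mixed_integer_volume n d A
    = (\<Sum>\<^sub>\<infinity>z\<in>F. emeasure (coord_lebesgue {n..<n+d}) (fibre n d A z))"
    unfolding mixed_integer_volume_def using assms by (intro infsum_cong_neutral) auto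
  then show ?thesis using assms(1) by simp
qed

text \<open>The two images are the integers to the right and to the left of 1/2. In either one the
  element with index \<open>j\<close> has excess exactly \<open>j\<close>, which turns sums over the
  window into geometric sums.\<close>

definition int_window :: "nat \<Rightarrow> real set" where
  "int_window M = (\<lambda>j. real (Suc j)) ` {..<M} \<union> (\<lambda>j. - real j) ` {..<M}"

lemma int_window_Ints: "int_window M \<subseteq> \<int>"
  by (auto simp: int_window_def)

lemma finite_int_window [simp]: "finite (int_window M)"
  by (simp add: int_window_def)

lemma mem_int_window:
  assumes "a \<in> \<int>" "excess a < real M"
  shows "a \<in> int_window M"
proof -
  obtain k :: int where k: "a = of_int k" using assms by (auto elim: Ints_cases)
  show ?thesis
  proof (cases "k \<ge> 1")
    case True
    then have "excess a = of_int (k - 1)" by (simp add: k excess_def abs_if)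
    then have "nat (k - 1) < M" using assms True by linarith
    moreover have "a = real (Suc (nat (k - 1)))" using True k by simp
    ultimately show ?thesis unfolding int_window_def by blast
  next
    case False
    then have "excess a = of_int (- k)" by (simp add: k excess_def abs_if)
    then have "nat (- k) < M" using assms False by linarith
    moreover have "a = - real (nat (- k))" using False k by simp
    ultimately show ?thesis unfolding int_window_def by blast
  qed
qed

text \<open>Each half of the window gives a truncated geometric series of ratio
  \<open>exp (- t)\<close>, so the bound does not depend on \<open>M\<close>.\<close>

lemma sum_int_window_le:
  assumes "t > 0"
  shows "(\<Sum>a\<in>int_window M. exp (- t * excess a)) \<le> 2 / (1 - exp (- t))"
proof -
  have q: "exp (- t) < 1" using assms by simp
  have "(\<Sum>a\<in>int_window M. exp (- t * excess a))
    = (\<Sum>a\<in>(\<lambda>j. real (Suc j)) ` {..<M}. exp (- t * excess a))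
     + (\<Sum>a\<in>(\<lambda>j. - real j) ` {..<M}. exp (- t * excess a))"
    unfolding int_window_def by (rule sum.union_disjoint) auto
  also have "\<dots> = (\<Sum>j<M. exp (- t) ^ j) + (\<Sum>j<M. exp (- t) ^ j)"
    by (intro arg_cong2[where f = "(+)"]; subst sum.reindex)
      (auto simp: inj_on_def excess_def exp_of_nat_mult[symmetric] mult.commute intro!: sum.cong)
  also have "(\<Sum>j<M. exp (- t) ^ j) \<le> 1 / (1 - exp (- t))"
    using q by (subst sum_gp_strict) (auto simp: field_simps)
  finally show ?thesis by simp
qed

text \<open>Reduces all volumes to finite sums of cube volumes \<open>g z\<close>: outside
  \<open>F\<close> the cubes are degenerate. The set \<open>A\<close> will be a halfspace.\<close>

lemma excess_body_cubes:
  fixes R :: real and n d :: nat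
  assumes d: "d \<ge> 1" and R: "R > 0"
  defines "g \<equiv> \<lambda>z. (2 * max 0 (R - (\<Sum>i<n. excess (z i)))) ^ d"
    and "F \<equiv> {..<n} \<rightarrow>\<^sub>E int_window (nat \<lceil>R\<rceil> + 1)"
    and "S \<equiv> excess_body n d R \<inter> mixed_integer_points n d"
  shows "z \<in> int_points n \<Longrightarrow>
      emeasure (coord_lebesgue {n..<n+d}) (fibre n d (S \<inter> A) z) \<le> ennreal (g z)"
    and "mixed_integer_volume n d S = ennreal (\<Sum>z\<in>F. g z)"
    and "mixed_integer_volume n d (S \<inter> A)
      = (\<Sum>z\<in>F. emeasure (coord_lebesgue {n..<n+d}) (fibre n d (S \<inter> A) z))"
    and "(\<Sum>z\<in>F. g z) \<le> (2 * R) ^ d * (2 / (1 - exp (- (real d / R)))) ^ n"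
proof -
  let ?E = "\<lambda>z. \<Sum>i<n. excess (z i)"
  let ?L = "coord_lebesgue {n..<n+d}"
  have F: "finite F" "F \<subseteq> int_points n"
    using int_window_Ints by (auto simp: F_def int_points_def finite_PiE PiE_iff)
  have S_fibre: "emeasure ?L (fibre n d S z) = ennreal (g z)" if "z \<in> int_points n" for z
    unfolding S_def g_def fibre_excess_body[OF that] by (rule emeasure_coord_cube[OF d])
  show mono: "emeasure ?L (fibre n d (S \<inter> A) z) \<le> ennreal (g z)" if "z \<in> int_points n" for z A
  proof -
    \<comment> \<open>Monotonicity asks for measurability of the larger set only, as
      \<open>emeasure\<close> is 0 on nonmeasurable sets.\<close>
    have "fibre n d S z \<in> sets (Pi\<^sub>M {n..<n+d} (\<lambda>_. lborel))"
      unfolding S_def fibre_excess_body[OF that] by (intro sets_PiM_I_finite) auto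
    then have "emeasure ?L (fibre n d (S \<inter> A) z) \<le> emeasure ?L (fibre n d S z)"
      by (intro emeasure_mono) (auto simp: fibre_def)
    then show ?thesis using S_fibre[OF that] by simp
  qed
  have outside: "g z = 0" if z: "z \<in> int_points n - F" for z
  proof -
    \<comment> \<open>One coordinate outside the window already has excess above \<open>R\<close>,
      and integrality keeps the other excesses from compensating.\<close>
    obtain i where i: "i < n" "z i \<notin> int_window (nat \<lceil>R\<rceil> + 1)"
      using z by (auto simp: F_def int_points_def PiE_iff)
    have Ints: "z k \<in> \<int>" if "k < n" for k using z that by (auto simp: int_points_def)
    have "R < real (nat \<lceil>R\<rceil> + 1)" using R by linarith
    also have "\<dots> \<le> excess (z i)" using mem_int_window[OF Ints] i by force
    also have "\<dots> \<le> ?E z"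
      using i Ints excess_nonneg_Ints by (intro member_le_sum) auto
    finally show ?thesis using d by (simp add: g_def)
  qed
  show sum: "mixed_integer_volume n d (S \<inter> A) = (\<Sum>z\<in>F. emeasure ?L (fibre n d (S \<inter> A) z))" for A
    using mono outside F by (intro mixed_integer_volume_eq_sum) (metis DiffD1 ennreal_0 le_zero_eq)+
  have "mixed_integer_volume n d S = (\<Sum>z\<in>F. ennreal (g z))"
    using sum[of UNIV] S_fibre F by (auto intro!: sum.cong)
  then show "mixed_integer_volume n d S = ennreal (\<Sum>z\<in>F. g z)"
    by (simp add: g_def)
  have "g z \<le> (2 * R) ^ d * (\<Prod>i<n. exp (- (real d / R) * excess (z i)))" for z
  proof -
    \<comment> \<open>The inequality 1 - s <= exp(-s) at s = E/R replaces the cube volume by an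
      exponential, which is a product over the coordinates of \<open>z\<close>; the sum over the
      product set \<open>F\<close> then factorises.\<close>
    have "1 - ?E z / R \<le> exp (- (?E z / R))" using exp_ge_add_one_self[of "- (?E z / R)"] by simp
    then have "R - ?E z \<le> R * exp (- (?E z / R))"
      using R by (simp add: field_simps)
    then have "max 0 (R - ?E z) \<le> R * exp (- (?E z / R))" using R by simp
    then have "g z \<le> (2 * (R * exp (- (?E z / R)))) ^ d"
      unfolding g_def by (intro power_mono) auto
    also have "\<dots> = (2 * R) ^ d * exp (- (real d / R) * ?E z)"
      by (simp add: power_mult_distrib flip: exp_of_nat_mult)
    also have "exp (- (real d / R) * ?E z) = (\<Prod>i<n. exp (- (real d / R) * excess (z i)))"
      by (simp add: exp_sum sum_distrib_left flip: sum_negf)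
    finally show ?thesis .
  qed
  then have "(\<Sum>z\<in>F. g z) \<le> (\<Sum>z\<in>F. (2 * R) ^ d * (\<Prod>i<n. exp (- (real d / R) * excess (z i))))"
    by (intro sum_mono)
  also have "\<dots> = (2 * R) ^ d * (\<Prod>i<n. \<Sum>a\<in>int_window (nat \<lceil>R\<rceil> + 1). exp (- (real d / R) * excess a))"
    unfolding F_def by (subst prod_sum_PiE) (auto simp: sum_distrib_left)
  also have "\<dots> \<le> (2 * R) ^ d * (\<Prod>i<n. 2 / (1 - exp (- (real d / R))))"
    using R d sum_int_window_le[of "real d / R"]
    by (intro mult_left_mono prod_mono) (auto intro!: sum_nonneg)
  finally show "(\<Sum>z\<in>F. g z) \<le> (2 * R) ^ d * (2 / (1 - exp (- (real d / R)))) ^ n"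
    by simp
qed

section \<open>Halfspace depth of the body\<close>

text \<open>In units of \<open>(2 * R) ^ d\<close> each vertex of the unit cube has mass 1, so the
  total is at least \<open>2 ^ n\<close>, and it is at most the power in \<open>small\<close>.
  Removing \<open>2 ^ n - 1\<close> vertices thus leaves at most the fraction \<open>\<eta>\<close>
  of the total.\<close>

lemma halfspace_depth_excess_body:
  fixes R \<eta> :: real and n d :: nat
  assumes n: "n \<ge> 1" and d: "d \<ge> 1" and R: "R > 0"
    and small: "(2 / (1 - exp (- (real d / R)))) ^ n - 2 ^ n + 1 \<le> \<eta> * 2 ^ n"
    and eta: "\<eta> > 0"
  defines "S \<equiv> excess_body n d R \<inter> mixed_integer_points n d"
  shows "0 < mixed_integer_volume n d S" "mixed_integer_volume n d S < \<infinity>"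
    and "y \<in> S \<Longrightarrow> halfspace_depth n d S y \<le> ennreal \<eta> * mixed_integer_volume n d S"
proof -
  let ?L = "coord_lebesgue {n..<n+d}"
  define g where "g z = (2 * max 0 (R - (\<Sum>i<n. excess (z i)))) ^ d" for z :: "nat \<Rightarrow> real"
  define F where "F = {..<n} \<rightarrow>\<^sub>E int_window (nat \<lceil>R\<rceil> + 1)"
  define V :: "(nat \<Rightarrow> real) set" where "V = {..<n} \<rightarrow>\<^sub>E {0, 1}"
  note cubes = excess_body_cubes[OF d R, where n = n, folded g_def F_def S_def]
  have F: "finite F" "F \<subseteq> int_points n"
    using int_window_Ints by (auto simp: F_def int_points_def finite_PiE PiE_iff)
  have "{0, 1} \<subseteq> int_window (nat \<lceil>R\<rceil> + 1)"
    using mem_int_window[of 0] mem_int_window[of 1] R by simp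
  then have VF: "V \<subseteq> F" unfolding V_def F_def by (intro PiE_mono) auto
  have finV: "finite V" using VF F finite_subset by blast
  have cardV: "card V = 2 ^ n" by (simp add: V_def card_funcsetE numeral_2_eq_2)
  have gV: "g w = (2 * R) ^ d" if "w \<in> V" for w
  proof -
    have "(\<Sum>i<n. excess (w i)) = 0"
    proof (rule sum.neutral, rule ballI)
      fix i assume "i \<in> {..<n}"
      then have "w i \<in> {0, 1}" using that unfolding V_def by blast
      then show "excess (w i) = 0" by auto
    qed
    then show ?thesis using R by (simp add: g_def)
  qed
  have g_nonneg: "g z \<ge> 0" for z by (simp add: g_def)
  have "(\<Sum>z\<in>V. g z) \<le> (\<Sum>z\<in>F. g z)"
    using F VF g_nonneg by (intro sum_mono2) auto
  then have lower: "2 ^ n * (2 * R) ^ d \<le> (\<Sum>z\<in>F. g z)"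
    by (simp add: gV cardV)
  moreover have "0 < 2 ^ n * (2 * R) ^ d" using R by simp
  ultimately show "0 < mixed_integer_volume n d S" "mixed_integer_volume n d S < \<infinity>"
    using cubes(2) by (auto simp: ennreal_less_top)
  assume y: "y \<in> S"
  \<comment> \<open>Zero weight on the continuous coordinates makes \<open>H\<close> keep or discard
    whole fibres. For every vertex w, \<open>a i * (y i - w i)\<close> is nonnegative: by
    integrality of \<open>y i\<close>, either w_i <= 1 <= y_i with sign 1, or y_i <= 0 <= w_i with
    sign -1.\<close>
  define a where "a = (\<lambda>i. if i < n then (if y i \<ge> 1 then 1 else -1) else 0 :: real)"
  define H where "H = {x \<in> coord_space {..<n+d}. (\<Sum>i<n+d. a i * x i) \<ge> (\<Sum>i<n+d. a i * y i)}"
  have y_Ints: "y i \<in> \<int>" if "i < n" for i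
    using y that by (auto simp: S_def mixed_integer_points_def int_points_def merge_def)
  have "\<exists>i<n+d. a i \<noteq> 0" using n by (intro exI[of _ 0]) (auto simp: a_def)
  then have "closed_halfspace (n + d) H" unfolding closed_halfspace_def H_def by blast
  moreover have "y \<in> H" using y by (auto simp: H_def S_def excess_body_def)
  ultimately have "halfspace_depth n d S y \<le> mixed_integer_volume n d (S \<inter> H)"
    unfolding halfspace_depth_def by (intro INF_lower) auto
  also have "\<dots> = (\<Sum>z\<in>F. emeasure ?L (fibre n d (S \<inter> H) z))" by (rule cubes(3))
  \<comment> \<open>Fibres over vertices other than the integer part of \<open>y\<close> are cut
    off; every other fibre is counted in full.\<close>
  also have "\<dots> \<le> (\<Sum>z\<in>F. ennreal (if z \<in> V - {restrict y {..<n}} then 0 else g z))"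
  proof (intro sum_mono)
    fix z assume z: "z \<in> F"
    have "fibre n d (S \<inter> H) z = {}" if zV: "z \<in> V - {restrict y {..<n}}"
    proof (rule ccontr)
      assume "fibre n d (S \<inter> H) z \<noteq> {}"
      then obtain x where "merge {..<n} {n..<n+d} (z, x) \<in> H" by (auto simp: fibre_def)
      moreover have "(\<Sum>i<n+d. a i * w i) = (\<Sum>i<n. a i * w i)" for w
        by (intro sum.mono_neutral_right) (auto simp: a_def)
      moreover have "(\<Sum>i<n. a i * merge {..<n} {n..<n+d} (z, x) i) = (\<Sum>i<n. a i * z i)"
        by (intro sum.cong) (auto simp: merge_def)
      ultimately have "(\<Sum>i<n. a i * y i) \<le> (\<Sum>i<n. a i * z i)" by (simp add: H_def)
      then have "0 \<ge> (\<Sum>i<n. a i * (y i - z i))"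
        by (simp add: right_diff_distrib sum_subtractf)
      moreover have nn: "0 \<le> a i * (y i - z i)" "a i * (y i - z i) = 0 \<longleftrightarrow> y i = z i"
        if i: "i < n" for i
      proof -
        have "z i \<in> {0, 1}" using zV i unfolding V_def by blast
        moreover obtain k where "y i = of_int k" using y_Ints[OF i] by (auto elim: Ints_cases)
        moreover have "k \<ge> 1 \<or> k \<le> 0" by linarith
        ultimately show "0 \<le> a i * (y i - z i)" "a i * (y i - z i) = 0 \<longleftrightarrow> y i = z i"
          using i by (auto simp: a_def)
      qed
      \<comment> \<open>A sum of nonnegative terms that is at most 0 has only zero terms, which
        forces \<open>z\<close> to be the integer part of \<open>y\<close>.\<close>
      moreover have "(\<Sum>i<n. a i * (y i - z i)) \<ge> 0" using nn by (intro sum_nonneg) auto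
      ultimately have "(\<Sum>i<n. a i * (y i - z i)) = 0" by linarith
      then have "\<forall>i\<in>{..<n}. a i * (y i - z i) = 0"
        using nn by (subst (asm) sum_nonneg_eq_0_iff) auto
      then have "\<forall>i<n. y i = z i" using nn by auto
      then have "z = restrict y {..<n}"
        using z by (intro ext) (auto simp: F_def PiE_iff extensional_def)
      then show False using zV by blast
    qed
    then show "emeasure ?L (fibre n d (S \<inter> H) z)
      \<le> ennreal (if z \<in> V - {restrict y {..<n}} then 0 else g z)"
      using cubes(1) z F by auto
  qed
  also have "\<dots> = ennreal (\<Sum>z\<in>F. if z \<in> V - {restrict y {..<n}} then 0 else g z)"
    using g_nonneg by (intro sum_ennreal) auto
  also have "\<dots> \<le> ennreal (\<eta> * (\<Sum>z\<in>F. g z))"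
  proof (rule ennreal_leI)
    let ?B = "V - {restrict y {..<n}}"
    have "(\<Sum>z\<in>F. if z \<in> ?B then 0 else g z) = (\<Sum>z\<in>F - ?B. g z)"
      using F by (intro sum.mono_neutral_cong_right) auto
    also have "\<dots> = (\<Sum>z\<in>F. g z) - (\<Sum>z\<in>?B. g z)"
      using F VF by (intro sum_diff) auto
    also have "(\<Sum>z\<in>?B. g z) = real (card ?B) * (2 * R) ^ d"
      by (simp add: gV)
    \<comment> \<open>At most one vertex is lost from the count, namely the integer part of
      \<open>y\<close> when it is itself a vertex.\<close>
    also have "real (card ?B) \<ge> 2 ^ n - 1"
      using cardV finV by (auto simp: card_Diff_singleton_if of_nat_diff)
    then have "(\<Sum>z\<in>F. g z) - real (card ?B) * (2 * R) ^ d
      \<le> (2 * R) ^ d * (2 / (1 - exp (- (real d / R)))) ^ n - (2 ^ n - 1) * (2 * R) ^ d"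
      using cubes(4) R by (intro diff_mono mult_right_mono) auto
    also have "\<dots> = (2 * R) ^ d * ((2 / (1 - exp (- (real d / R)))) ^ n - 2 ^ n + 1)"
      by (simp add: algebra_simps)
    also have "\<dots> \<le> (2 * R) ^ d * (\<eta> * 2 ^ n)"
      using small R by (intro mult_left_mono) auto
    also have "\<dots> \<le> \<eta> * (\<Sum>z\<in>F. g z)"
      using mult_left_mono[OF lower, of \<eta>] eta by (simp add: mult_ac)
    finally show "(\<Sum>z\<in>F. if z \<in> ?B then 0 else g z) \<le> \<eta> * (\<Sum>z\<in>F. g z)" .
  qed
  also have "\<dots> = ennreal \<eta> * mixed_integer_volume n d S"
    using eta cubes(2) by (simp add: ennreal_mult' less_imp_le)
  finally show "halfspace_depth n d S y \<le> ennreal \<eta> * mixed_integer_volume n d S" .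
qed

section \<open>Choice of parameters and conclusion\<close>

text \<open>The allowance \<open>\<eta> * 2 ^ n\<close> is split in half. By Bernoulli, (1 - q)^n >=
  1 - \<eta>/4, so the mass off the vertices is at most (\<eta>/2) 2^n; the single remaining vertex
  costs 1, again at most (\<eta>/2) 2^n.\<close>

lemma vertex_share_bound:
  fixes q \<eta> :: real
  assumes n: "n \<ge> 1" and eta: "0 < \<eta>" "\<eta> < 1" and "1 / 2 ^ n \<le> \<eta> / 2"
    and q: "0 \<le> q" "q \<le> \<eta> / (4 * real n)"
  shows "(2 / (1 - q)) ^ n - 2 ^ n + 1 \<le> \<eta> * 2 ^ n"
proof -
  have nq: "real n * q \<le> \<eta> / 4" using q n by (simp add: field_simps)
  have "\<eta> / (4 * real n) \<le> \<eta> / 4" using eta n by (simp add: field_simps)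
  then have q1: "q < 1" using q eta by linarith
  have "1 \<le> (1 + \<eta> / 2) * (1 - \<eta> / 4)" using eta by (simp add: field_simps)
  also have "\<dots> \<le> (1 + \<eta> / 2) * (1 - q) ^ n"
    using Bernoulli_inequality[of "- q" n] q1 nq eta by (intro mult_left_mono) auto
  finally have "1 / (1 - q) ^ n \<le> 1 + \<eta> / 2" using q1 by (simp add: pos_divide_le_eq)
  then have "2 ^ n * (1 / (1 - q) ^ n) \<le> 2 ^ n * (1 + \<eta> / 2)" by (intro mult_left_mono) auto
  moreover have "1 \<le> 2 ^ n * (\<eta> / 2)" using assms(4) by (simp add: field_simps)
  ultimately show ?thesis by (simp add: power_divide algebra_simps)
qed

text \<open>Positive and finite volume is recorded because the nonexistence of a constant
  \<open>c\<close> rests on a strict comparison of two multiples of that volume.\<close>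

lemma shallow_convex_bodies:
  fixes \<eta> :: real and \<kappa> :: "nat \<Rightarrow> real"
  assumes eta: "0 < \<eta>" "\<eta> < 1"
    and pos: "\<And>m. m \<ge> 1 \<Longrightarrow> \<kappa> m > 0"
    and small_o: "\<kappa> \<in> o(\<lambda>m. real m)"
  shows "\<exists>m\<^sub>0\<ge>1. \<forall>m\<ge>m\<^sub>0. \<exists>n\<ge>1. \<exists>d\<ge>1. n + d = m \<and>
    (\<exists>C. convex_body {..<n + d} C \<and> contains_translate n (proj n C) (\<kappa> m) (linf_ball n) \<and>
      (let S = C \<inter> mixed_integer_points n d in
        0 < mixed_integer_volume n d S \<and> mixed_integer_volume n d S < \<infinity> \<and>
        (\<forall>y\<in>S. halfspace_depth n d S y \<le> ennreal \<eta> * mixed_integer_volume n d S)))"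
proof -
  obtain n0 where n0: "(1 / 2 :: real) ^ n0 < \<eta> / 2"
    using real_arch_pow_inv[of "\<eta> / 2" "1 / 2"] eta by auto
  define n where "n = Suc n0"
  have n: "n \<ge> 1" by (simp add: n_def)
  have two: "1 / 2 ^ n \<le> \<eta> / 2" using n0 by (simp add: n_def power_divide field_simps)
  \<comment> \<open>A lower bound on \<open>real d / R\<close> that brings \<open>q\<close> below
    the threshold of \<open>vertex_share_bound\<close>; the maximum makes \<open>L\<close> visibly
    positive.\<close>
  define L where "L = max 1 (- ln (\<eta> / (4 * real n)))"
  have L: "exp (- L) \<le> \<eta> / (4 * real n)" "L > 0"
  proof -
    have "- L \<le> ln (\<eta> / (4 * real n))" by (simp add: L_def)
    then show "exp (- L) \<le> \<eta> / (4 * real n)"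
      using eta n ln_ge_iff[of "\<eta> / (4 * real n)" "- L"] by simp
  qed (simp add: L_def)
  \<comment> \<open>Since \<open>n\<close> is fixed, this constant is legitimate. It gives 2 L R <=
    m, and m <= 2 d once m >= 2 n, so L R <= d; the factor 2 pays for passing from \<open>m\<close>
    to \<open>d\<close>.\<close>
  have "\<forall>\<^sub>F m in at_top. norm (\<kappa> m) \<le> 1 / (2 * real n * L) * norm (real m)"
    using n L by (intro landau_o.smallD[OF small_o]) auto
  then obtain m1 where m1: "\<And>m. m \<ge> m1 \<Longrightarrow> \<bar>\<kappa> m\<bar> \<le> 1 / (2 * real n * L) * real m"
    by (auto simp: eventually_at_top_linorder)
  have "\<exists>n\<ge>1. \<exists>d\<ge>1. n + d = m \<and>
    (\<exists>C. convex_body {..<n + d} C \<and> contains_translate n (proj n C) (\<kappa> m) (linf_ball n) \<and>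
      (let S = C \<inter> mixed_integer_points n d in
        0 < mixed_integer_volume n d S \<and> mixed_integer_volume n d S < \<infinity> \<and>
        (\<forall>y\<in>S. halfspace_depth n d S y \<le> ennreal \<eta> * mixed_integer_volume n d S)))"
    if m: "m \<ge> max m1 (2 * n)" for m
  proof -
    define d where "d = m - n"
    define R where "R = real n * \<kappa> m"
    have d: "d \<ge> 1" "n + d = m" "real m \<le> 2 * real d" using m n by (auto simp: d_def)
    have k: "\<kappa> m > 0" using pos m n by auto
    then have R: "R > 0" using n by (simp add: R_def)
    have "\<kappa> m * (2 * real n * L) \<le> real m"
      using m1[of m] m k n L by (simp add: field_simps)
    then have "L * R \<le> real d" using d by (simp add: R_def mult_ac)
    then have "L \<le> real d / R" using R by (simp add: pos_le_divide_eq)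
    then have "exp (- (real d / R)) \<le> exp (- L)" by simp
    then have q: "exp (- (real d / R)) \<le> \<eta> / (4 * real n)" using L by linarith
    have "(2 / (1 - exp (- (real d / R)))) ^ n - 2 ^ n + 1 \<le> \<eta> * 2 ^ n"
      using vertex_share_bound[OF n eta two _ q] by simp
    note depth = halfspace_depth_excess_body[OF n d(1) R this eta(1)]
    show ?thesis
      using n d depth convex_body_excess_body[OF d(1) R]
        contains_translate_excess_body[OF n less_imp_le[OF k], folded R_def]
      by (intro exI[of _ n] exI[of _ d] exI[of _ "excess_body n d R"] conjI) (auto simp: Let_def)
  qed
  then show ?thesis
    using n by (intro exI[of _ "max m1 (2 * n)"]) auto
qed

theorem corollary5p2:
  fixes \<eta> :: real and \<kappa> :: "nat \<Rightarrow> real"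
  assumes "0 < \<eta>" and "\<eta> < 1"
    and "\<And>m. m \<ge> 1 \<Longrightarrow> \<kappa> m > 0"
    and "\<kappa> \<in> o(\<lambda>m. real m)"
  shows
    "(\<exists>m\<^sub>0\<ge>1. \<forall>m\<ge>m\<^sub>0. \<exists>n\<ge>1. \<exists>d\<ge>1. n + d = m \<and>
        (\<exists>C. convex_body {..<n + d} C \<and>
             contains_translate n (proj n C) (\<kappa> m) (linf_ball n) \<and>
             (let S = C \<inter> mixed_integer_points n d in
               (SUP y\<in>S. halfspace_depth n d S y) \<le> ennreal \<eta> * mixed_integer_volume n d S)))
     \<and>
     \<not> (\<exists>c::real. c > 0 \<and>
          (\<forall>n\<ge>1. \<forall>d\<ge>1. \<forall>C.
             convex_body {..<n + d} C \<and>
             contains_translate n (proj n C) (\<kappa> (n + d)) (linf_ball n) \<longrightarrow>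
             (let S = C \<inter> mixed_integer_points n d in
               \<exists>y\<in>S. halfspace_depth n d S y \<ge> ennreal c * mixed_integer_volume n d S)))"
proof (intro conjI notI)
  show "\<exists>m\<^sub>0\<ge>1. \<forall>m\<ge>m\<^sub>0. \<exists>n\<ge>1. \<exists>d\<ge>1. n + d = m \<and>
      (\<exists>C. convex_body {..<n + d} C \<and>
           contains_translate n (proj n C) (\<kappa> m) (linf_ball n) \<and>
           (let S = C \<inter> mixed_integer_points n d in
             (SUP y\<in>S. halfspace_depth n d S y) \<le> ennreal \<eta> * mixed_integer_volume n d S))"
    using shallow_convex_bodies[OF assms] unfolding Let_def SUP_le_iff by meson
next
  assume "\<exists>c::real. c > 0 \<and>
      (\<forall>n\<ge>1. \<forall>d\<ge>1. \<forall>C.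
         convex_body {..<n + d} C \<and>
         contains_translate n (proj n C) (\<kappa> (n + d)) (linf_ball n) \<longrightarrow>
         (let S = C \<inter> mixed_integer_points n d in
           \<exists>y\<in>S. halfspace_depth n d S y \<ge> ennreal c * mixed_integer_volume n d S))"
  then obtain c :: real where c: "c > 0"
    and deep: "\<And>n d C. n \<ge> 1 \<Longrightarrow> d \<ge> 1 \<Longrightarrow> convex_body {..<n + d} C \<Longrightarrow>
      contains_translate n (proj n C) (\<kappa> (n + d)) (linf_ball n) \<Longrightarrow>
      \<exists>y\<in>C \<inter> mixed_integer_points n d. halfspace_depth n d (C \<inter> mixed_integer_points n d) y
        \<ge> ennreal c * mixed_integer_volume n d (C \<inter> mixed_integer_points n d)"
    unfolding Let_def by meson
  \<comment> \<open>Strictly below both \<open>c\<close> and 1: a fraction admissible for the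
    shallow bodies that contradicts depth \<open>c\<close> in a single dimension.\<close>
  define e where "e = min c 1 / 2"
  have e: "0 < e" "e < 1" "e < c" using c by (auto simp: e_def)
  obtain n d C where nd: "n \<ge> 1" "d \<ge> 1" and C: "convex_body {..<n + d} C"
      "contains_translate n (proj n C) (\<kappa> (n + d)) (linf_ball n)"
    and vol: "0 < mixed_integer_volume n d (C \<inter> mixed_integer_points n d)"
      "mixed_integer_volume n d (C \<inter> mixed_integer_points n d) < \<infinity>"
    and shallow: "\<And>y. y \<in> C \<inter> mixed_integer_points n d \<Longrightarrow>
      halfspace_depth n d (C \<inter> mixed_integer_points n d) y
        \<le> ennreal e * mixed_integer_volume n d (C \<inter> mixed_integer_points n d)"
    using shallow_convex_bodies[OF e(1,2) assms(3,4)] unfolding Let_def by (metis order_refl)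
  define v where "v = mixed_integer_volume n d (C \<inter> mixed_integer_points n d)"
  have "ennreal c * v \<le> ennreal e * v"
    using deep[OF nd C] shallow order_trans unfolding v_def by blast
  moreover have "ennreal e * v < ennreal c * v"
    using vol e by (intro ennreal_mult_strict_right_mono) (auto simp: v_def ennreal_less_iff)
  ultimately show False by simp
qed

end
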